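(* Let $p>0$, let $J\subset\mathbb{R}^+$ be an interval with $(0,1)\subset J$, let $K\subset\mathbb{R}^+$ be a $p$-convex set, let $h:J\to\mathbb{R}^+$ be a non-zero super-multiplicative function, and let $f:K\to\mathbb{R}^+$ be an operator $(p,h)$-convex function. Then for any pair of positive semidefinite matrices $A,B\in\mathbb{M}_n$ with spectra in $K$ and any matrices $C,D\in\mathbb{M}_n$ such that $CC^*+DD^*=I_n$, $$f\big([CA^pC^*+DB^pD^*]^{1/p}\big)\le 2h\big(\tfrac12\big)\big(Cf(A)C^*+Df(B)D^*\big).$$
   Context: $\mathbb{R}^+=[0,\infty)$. $\mathbb{M}_n$ is the space of $n\times n$ complex matrices, $\mathbb{M}_n^+$ the set of positive semidefinite ones, $I_n$ the identity; $A\le B$ means $B-A\in\mathbb{M}_n^+$; $\sigma(A)$ is the spectrum; functions of self-adjoint matrices are defined by functional calculus. A set $K\subset\mathbb{R}^+$ is $p$-convex if $(\lambda x^p+(1-\lambda)y^p)^{1/p}\in K$ for all $x,y\in K$, $\lambda\in[0,1]$. A function $h:J\to\mathbb{R}^+$ is super-multiplicative if $h(xy)\ge h(x)h(y)$ for all $x,y\in J$ (with $xy\in J$). For a non-zero (i.e. not identically zero) super-multiplicative $h:J\to\mathbb{R}^+$, a non-negative continuous function $f$ on $K$ is operator $(p,h)$-convex if $$f\big([\alpha A^p+(1-\alpha)B^p]^{1/p}\big)\le h(\alpha)f(A)+h(1-\alpha)f(B)$$ for every $n\ge1$, all $A,B\in\mathbb{M}_n^+$ with $\sigma(A),\sigma(B)\subset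 K$, and all $\alpha\in(0,1)$. *)

theory Defs
  imports
    "HOL-Analysis.Analysis"
    "Jordan_Normal_Form.Schur_Decomposition"
    "Jordan_Normal_Form.Spectral_Radius"
begin

definition mat_hermitian :: "complex mat \<Rightarrow> bool" where
  "mat_hermitian A \<longleftrightarrow> square_mat A \<and> mat_adjoint A = A"

text \<open>The inequality is in the order of \<^theory>\<open>HOL-Library.Complex_Order\<close>: the value of the
  quadratic form is real and non-negative.\<close>

definition mat_psd :: "complex mat \<Rightarrow> bool" where
  "mat_psd A \<longleftrightarrow> mat_hermitian A \<and> (\<forall>v \<in> carrier_vec (dim_row A). 0 \<le> (A *\<^sub>v v) \<bullet>c v)"

definition loewner_le :: "complex mat \<Rightarrow> complex mat \<Rightarrow> bool" (infix "\<le>\<^sub>L" 50) where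
  "A \<le>\<^sub>L B \<longleftrightarrow> dim_row A = dim_row B \<and> dim_col A = dim_col B \<and> mat_psd (B - A)"

definition mat_unitary :: "nat \<Rightarrow> complex mat \<Rightarrow> bool" where
  "mat_unitary n U \<longleftrightarrow> U \<in> carrier_mat n n \<and>
     U * mat_adjoint U = 1\<^sub>m n \<and> mat_adjoint U * U = 1\<^sub>m n"

text \<open>Functional calculus through a unitary diagonalisation. It is meaningful for Hermitian
  \<open>A\<close>, and depends only on the values of \<open>f\<close> on the spectrum of \<open>A\<close>; so it may be used for a
  function given on a set \<open>K\<close> that contains the spectrum, whatever \<open>f\<close> is outside \<open>K\<close>.
  Lemma \<open>mat_fun_eq\<close> below shows that the result does not depend on the diagonalisation.\<close>

definition mat_fun :: "(real \<Rightarrow> real) \<Rightarrow> complex mat \<Rightarrow> complex mat" where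
  "mat_fun f A = (THE B. \<exists>U d. mat_unitary (dim_row A) U \<and>
     A = U * mat_diag (dim_row A) (\<lambda>i. complex_of_real (d i)) * mat_adjoint U \<and>
     B = U * mat_diag (dim_row A) (\<lambda>i. complex_of_real (f (d i))) * mat_adjoint U)"

text \<open>Only used for positive semidefinite \<open>A\<close> and \<open>p > 0\<close>; note \<^prop>\<open>0 powr p = (0::real)\<close>.\<close>

abbreviation mat_powr :: "complex mat \<Rightarrow> real \<Rightarrow> complex mat" where
  "mat_powr A p \<equiv> mat_fun (\<lambda>x. x powr p) A"

lemma mat_adjoint_carrier [simp]:
  fixes A :: "complex mat"
  shows "A \<in> carrier_mat n m \<Longrightarrow> mat_adjoint A \<in> carrier_mat m n"
  by (auto simp: mat_adjoint_def mat_of_rows_def)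

lemma mat_fun_eq:
  assumes U: "mat_unitary n U"
    and A: "A = U * mat_diag n (\<lambda>i. complex_of_real (d i)) * mat_adjoint U"
  shows "mat_fun f A = U * mat_diag n (\<lambda>i. complex_of_real (f (d i))) * mat_adjoint U"
proof -
  have Uc: "U \<in> carrier_mat n n" and UU: "U * mat_adjoint U = 1\<^sub>m n" "mat_adjoint U * U = 1\<^sub>m n"
    using U by (auto simp: mat_unitary_def)
  have n: "dim_row A = n" using A Uc by auto
  note mm = mult_carrier_mat[of _ n n _ n]
  have cancel: "X = Y" if "P * X * Q = P * Y * Q" "P' * P = 1\<^sub>m n" "Q * Q' = 1\<^sub>m n"
    "{X, Y, P, Q, P', Q'} \<subseteq> carrier_mat n n" for X Y P Q P' Q' :: "complex mat"
  proof -
    have c: "X \<in> carrier_mat n n" "Y \<in> carrier_mat n n" "P \<in> carrier_mat n n"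
      "Q \<in> carrier_mat n n" "P' \<in> carrier_mat n n" "Q' \<in> carrier_mat n n"
      using that(4) by auto
    have "P' * (P * Z * Q) * Q' = (P' * P) * Z * (Q * Q')" if "Z \<in> carrier_mat n n" for Z
      using that c by (simp add: mm assoc_mult_mat[of _ n n _ n _ n])
    then have "P' * (P * Z * Q) * Q' = Z" if "Z \<in> carrier_mat n n" for Z
      using that \<open>P' * P = 1\<^sub>m n\<close> \<open>Q * Q' = 1\<^sub>m n\<close> by simp
    from this[OF c(1)] this[OF c(2)] show ?thesis unfolding that(1) by (rule trans[OF sym])
  qed
  show ?thesis
    unfolding mat_fun_def n
  proof (rule the_equality)
    fix B
    assume "\<exists>V e. mat_unitary n V \<and>
      A = V * mat_diag n (\<lambda>i. complex_of_real (e i)) * mat_adjoint V \<and>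
      B = V * mat_diag n (\<lambda>i. complex_of_real (f (e i))) * mat_adjoint V"
    then obtain V e where V: "mat_unitary n V"
      and A': "A = V * mat_diag n (\<lambda>i. complex_of_real (e i)) * mat_adjoint V"
      and B: "B = V * mat_diag n (\<lambda>i. complex_of_real (f (e i))) * mat_adjoint V" by blast
    have Vc: "V \<in> carrier_mat n n" and VV: "V * mat_adjoint V = 1\<^sub>m n" "mat_adjoint V * V = 1\<^sub>m n"
      using V by (auto simp: mat_unitary_def)
    define W where "W = mat_adjoint V * U"
    have Wc: "W \<in> carrier_mat n n" using Uc Vc by (simp add: W_def mm)
    have conj_U: "mat_adjoint V * (U * X * mat_adjoint U) * U = W * X"
      if "X \<in> carrier_mat n n" for X
      using that Uc Vc UU by (simp add: W_def mm assoc_mult_mat[of _ n n _ n _ n])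
    have "mat_adjoint V * (V * X * mat_adjoint V) * U = (mat_adjoint V * V) * X * W"
      if "X \<in> carrier_mat n n" for X
      using that Uc Vc by (simp add: W_def mm assoc_mult_mat[of _ n n _ n _ n])
    then have conj_V: "mat_adjoint V * (V * X * mat_adjoint V) * U = X * W"
      if "X \<in> carrier_mat n n" for X
      using that VV by simp
    have eq: "W * mat_diag n (\<lambda>i. complex_of_real (d i)) = mat_diag n (\<lambda>i. complex_of_real (e i)) * W"
      by (rule trans[OF conj_U[OF mat_diag_dim, of "\<lambda>i. complex_of_real (d i)", folded A, symmetric]
            conj_V[OF mat_diag_dim, of "\<lambda>i. complex_of_real (e i)", folded A']])
    have ent: "W $$ (i, j) * complex_of_real (d j) = complex_of_real (e i) * W $$ (i, j)"
      if "i < n" "j < n" for i j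
      using arg_cong[OF eq, of "\<lambda>M. M $$ (i, j)"] that Wc
      by (simp add: mat_diag_mult_left[OF Wc] mat_diag_mult_right[OF Wc])
    have "W $$ (i, j) * complex_of_real (f (d j)) = complex_of_real (f (e i)) * W $$ (i, j)"
      if "i < n" "j < n" for i j
      using ent[OF that] by (cases "W $$ (i, j) = 0") auto
    then have "W * mat_diag n (\<lambda>i. complex_of_real (f (d i)))
        = mat_diag n (\<lambda>i. complex_of_real (f (e i))) * W"
      using Wc by (auto simp: mat_diag_mult_left[OF Wc] mat_diag_mult_right[OF Wc])
    then have "mat_adjoint V * (U * mat_diag n (\<lambda>i. complex_of_real (f (d i))) * mat_adjoint U) * U
        = mat_adjoint V * B * U"
      unfolding B by (simp only: conj_U[OF mat_diag_dim] conj_V[OF mat_diag_dim])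
    moreover have "{U * mat_diag n (\<lambda>i. complex_of_real (f (d i))) * mat_adjoint U, B,
        mat_adjoint V, U, V, mat_adjoint U} \<subseteq> carrier_mat n n"
      unfolding B using Uc Vc by (simp add: mm)
    ultimately show "B = U * mat_diag n (\<lambda>i. complex_of_real (f (d i))) * mat_adjoint U"
      using cancel VV(1) UU(1) by metis
  qed (use assms in blast)
qed

definition p_convex :: "real \<Rightarrow> real set \<Rightarrow> bool" where
  "p_convex p K \<longleftrightarrow> K \<subseteq> {0..} \<and>
     (\<forall>x\<in>K. \<forall>y\<in>K. \<forall>t\<in>{0..1}. (t * x powr p + (1 - t) * y powr p) powr (1 / p) \<in> K)"

definition super_multiplicative_on :: "real set \<Rightarrow> (real \<Rightarrow> real) \<Rightarrow> bool" where
  "super_multiplicative_on J h \<longleftrightarrow>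
     (\<forall>x\<in>J. \<forall>y\<in>J. x * y \<in> J \<longrightarrow> h x * h y \<le> h (x * y))"

definition operator_ph_convex_on ::
    "real \<Rightarrow> (real \<Rightarrow> real) \<Rightarrow> real set \<Rightarrow> (real \<Rightarrow> real) \<Rightarrow> bool" where
  "operator_ph_convex_on p h K f \<longleftrightarrow>
     continuous_on K f \<and> (\<forall>x\<in>K. 0 \<le> f x) \<and>
     (\<forall>n\<ge>1. \<forall>A \<in> carrier_mat n n. \<forall>B \<in> carrier_mat n n.
        mat_psd A \<and> mat_psd B \<and>
        spectrum A \<subseteq> complex_of_real ` K \<and> spectrum B \<subseteq> complex_of_real ` K \<longrightarrow>
        (\<forall>\<alpha>\<in>{0<..<1}.
           mat_fun f (mat_powr (complex_of_real \<alpha> \<cdot>\<^sub>m mat_powr A p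
                                + complex_of_real (1 - \<alpha>) \<cdot>\<^sub>m mat_powr B p) (1 / p))
           \<le>\<^sub>L complex_of_real (h \<alpha>) \<cdot>\<^sub>m mat_fun f A
               + complex_of_real (h (1 - \<alpha>)) \<cdot>\<^sub>m mat_fun f B))"

end

theory Submission
  imports Defs
begin

text \<open>
  The row \<open>W = [C D]\<close> is a coisometry and \<open>C A\<^sup>p C\<^sup>* + D B\<^sup>p D\<^sup>* = W X\<^sup>p W\<^sup>*\<close> for \<open>X = A \<oplus> B\<close>.
  Dilate \<open>W\<close> to a unitary \<open>U\<close> and let \<open>T = U (X \<oplus> E) U\<^sup>*\<close>, where \<open>E\<close> is a scalar matrix with
  entry in the spectrum of \<open>X\<close>; then \<open>W g(X) W\<^sup>*\<close> is a corner of \<open>g(T)\<close> for every \<open>g\<close>. With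
  \<open>V = 1 \<oplus> -1\<close>, averaging \<open>T\<^sup>p\<close> and \<open>V T\<^sup>p V\<^sup>*\<close> deletes the off-diagonal blocks, so operator
  \<open>(p, h)\<close>-convexity of \<open>f\<close> at \<open>\<alpha> = 1/2\<close> for \<open>T\<close> and \<open>V T V\<^sup>*\<close>, restricted to the corner,
  is the assertion.
\<close>

section \<open>Adjoints of complex matrices\<close>

lemma index_mat_adjoint [simp]:
  fixes A :: "complex mat"
  shows "i < dim_col A \<Longrightarrow> j < dim_row A \<Longrightarrow> mat_adjoint A $$ (i, j) = cnj (A $$ (j, i))"
    and "dim_row (mat_adjoint A) = dim_col A"
    and "dim_col (mat_adjoint A) = dim_row A"
  by (auto simp: mat_adjoint_def mat_of_rows_def)

lemma mat_adjoint_adjoint [simp]: "mat_adjoint (mat_adjoint A) = (A :: complex mat)"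
  by (rule eq_matI) auto

lemma mat_adjoint_zero [simp]: "mat_adjoint (0\<^sub>m n m) = (0\<^sub>m m n :: complex mat)"
  by (rule eq_matI) auto

lemma mat_adjoint_one [simp]: "mat_adjoint (1\<^sub>m n) = (1\<^sub>m n :: complex mat)"
  by (rule eq_matI) auto

lemma mat_adjoint_uminus [simp]: "mat_adjoint (- A) = - mat_adjoint (A :: complex mat)"
  by (rule eq_matI) auto

lemma mat_adjoint_minus:
  fixes A :: "complex mat"
  assumes "A \<in> carrier_mat n m" "B \<in> carrier_mat n m"
  shows "mat_adjoint (A - B) = mat_adjoint A - mat_adjoint B"
  using assms by (intro eq_matI) auto

lemma mat_adjoint_mult:
  fixes A :: "complex mat"
  assumes "A \<in> carrier_mat n m" "B \<in> carrier_mat m k"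
  shows "mat_adjoint (A * B) = mat_adjoint B * mat_adjoint A"
  using assms by (intro eq_matI) (auto simp: scalar_prod_def mult.commute)

lemma mat_adjoint_diag_real [simp]:
  "mat_adjoint (mat_diag n (\<lambda>i. complex_of_real (d i))) = mat_diag n (\<lambda>i. complex_of_real (d i))"
  by (rule eq_matI) (auto simp: mat_diag_def)

lemma mat_adjoint_four_block:
  fixes A :: "complex mat"
  assumes "A \<in> carrier_mat n1 m1" "B \<in> carrier_mat n1 m2"
    "C \<in> carrier_mat n2 m1" "D \<in> carrier_mat n2 m2"
  shows "mat_adjoint (four_block_mat A B C D)
    = four_block_mat (mat_adjoint A) (mat_adjoint C) (mat_adjoint B) (mat_adjoint D)"
  using assms by (intro eq_matI) auto

lemma cscalar_prod_mat_adjoint: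
  fixes A :: "complex mat"
  assumes A: "A \<in> carrier_mat n m" and v: "v \<in> carrier_vec m" and w: "w \<in> carrier_vec n"
  shows "(A *\<^sub>v v) \<bullet>c w = v \<bullet>c (mat_adjoint A *\<^sub>v w)"
proof -
  have "(A *\<^sub>v v) \<bullet>c w = (\<Sum>i<n. \<Sum>j<m. A $$ (i, j) * v $ j * cnj (w $ i))"
    using assms by (simp add: scalar_prod_def sum_distrib_right atLeast0LessThan)
  also have "\<dots> = (\<Sum>j<m. \<Sum>i<n. A $$ (i, j) * v $ j * cnj (w $ i))"
    by (rule sum.swap)
  also have "\<dots> = v \<bullet>c (mat_adjoint A *\<^sub>v w)"
    using assms by (simp add: scalar_prod_def sum_distrib_left atLeast0LessThan mult_ac)
  finally show ?thesis .
qed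

section \<open>Unitary matrices and products of block-diagonal matrices\<close>

lemma mat_unitaryD:
  assumes "mat_unitary n U"
  shows "U \<in> carrier_mat n n" "mat_adjoint U \<in> carrier_mat n n"
    "U * mat_adjoint U = 1\<^sub>m n" "mat_adjoint U * U = 1\<^sub>m n"
  using assms by (auto simp: mat_unitary_def)

lemma mat_unitary_one: "mat_unitary n (1\<^sub>m n)"
  by (simp add: mat_unitary_def)

lemma mat_unitary_mult:
  assumes "mat_unitary n U" "mat_unitary n V"
  shows "mat_unitary n (U * V)"
proof -
  note U = mat_unitaryD[OF assms(1)] and V = mat_unitaryD[OF assms(2)]
  have "U * V * mat_adjoint (U * V) = U * (V * mat_adjoint V) * mat_adjoint U"
    using U(1,2) V(1,2) by (simp only: mat_adjoint_mult[OF U(1) V(1)] mult_carrier_mat[of _ n n _ n]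
        assoc_mult_mat[of _ n n _ n _ n])
  moreover have "mat_adjoint (U * V) * (U * V) = mat_adjoint V * (mat_adjoint U * U) * V"
    using U(1,2) V(1,2) by (simp only: mat_adjoint_mult[OF U(1) V(1)] mult_carrier_mat[of _ n n _ n]
        assoc_mult_mat[of _ n n _ n _ n])
  ultimately show ?thesis
    using U V by (simp add: mat_unitary_def mult_carrier_mat[of _ n n _ n])
qed

lemma mult_block_diag_mat:
  assumes "A \<in> carrier_mat n n" "B \<in> carrier_mat m m" "C \<in> carrier_mat n n" "D \<in> carrier_mat m m"
  shows "four_block_mat A (0\<^sub>m n m) (0\<^sub>m m n) B * four_block_mat C (0\<^sub>m n m) (0\<^sub>m m n) D
    = four_block_mat (A * C) (0\<^sub>m n m) (0\<^sub>m m n) (B * D :: 'a :: semiring_0 mat)"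
proof -
  have "A * C \<in> carrier_mat n n" "B * D \<in> carrier_mat m m"
    using assms by (auto intro: mult_carrier_mat)
  then show ?thesis
    using assms by (simp add: mult_four_block_mat[OF assms(1) _ _ assms(2,3) _ _ assms(4)])
qed

lemma mat_unitary_four_block:
  assumes "mat_unitary n U" "mat_unitary m V"
  shows "mat_unitary (n + m) (four_block_mat U (0\<^sub>m n m) (0\<^sub>m m n) V)"
proof -
  note U = mat_unitaryD[OF assms(1)] and V = mat_unitaryD[OF assms(2)]
  show ?thesis
    using U V unfolding mat_unitary_def
    by (simp add: mat_adjoint_four_block[OF U(1) _ _ V(1)] mult_block_diag_mat)
qed

section \<open>Unitary diagonalisation and the functional calculus\<close>

text \<open>Carrying the unitary \<open>U\<close> and the real eigenvalues \<open>d\<close> as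
  arguments lets identities between values of \<open>mat_fun\<close> be read off from
  \<open>d\<close>. Only the values \<open>d i\<close> with \<open>i < n\<close> matter.\<close>

definition unitary_diag :: "nat \<Rightarrow> complex mat \<Rightarrow> complex mat \<Rightarrow> (nat \<Rightarrow> real) \<Rightarrow> bool" where
  "unitary_diag n A U d \<longleftrightarrow> mat_unitary n U \<and>
     A = U * mat_diag n (\<lambda>i. complex_of_real (d i)) * mat_adjoint U"

lemma unitary_diag_carrier:
  assumes "unitary_diag n A U d"
  shows "A \<in> carrier_mat n n"
proof -
  have "mat_unitary n U" "A = U * mat_diag n (\<lambda>i. complex_of_real (d i)) * mat_adjoint U"
    using assms by (auto simp: unitary_diag_def)
  then show ?thesis
    using mat_unitaryD[OF \<open>mat_unitary n U\<close>] by (simp add: mult_carrier_mat[of _ n n _ n])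
qed

text \<open>The unitary stays the same, so the rule can be iterated, as for
  \<open>mat_fun f (mat_powr Z (1 / p))\<close>.\<close>

lemma unitary_diag_mat_fun:
  assumes "unitary_diag n A U d"
  shows "unitary_diag n (mat_fun g A) U (\<lambda>i. g (d i))"
  using assms mat_fun_eq unfolding unitary_diag_def by blast

text \<open>Serves to prove two values of the functional calculus equal: both are diagonalised by
  the same \<open>U\<close> and \<open>d\<close>.\<close>

lemma unitary_diag_unique:
  "unitary_diag n A U d \<Longrightarrow> unitary_diag n B U d \<Longrightarrow> A = B"
  by (simp add: unitary_diag_def)

lemma unitary_diag_hermitian:
  assumes "unitary_diag n A U d"
  shows "mat_adjoint A = A"
proof -
  have u: "mat_unitary n U" and A: "A = U * mat_diag n (\<lambda>i. complex_of_real (d i)) * mat_adjoint U"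
    using assms by (auto simp: unitary_diag_def)
  note U = mat_unitaryD[OF u]
  show ?thesis
    using U(1,2) unfolding A
    by (simp add: mat_adjoint_mult[of _ n n _ n] mult_carrier_mat[of _ n n _ n]
        assoc_mult_mat[of _ n n _ n _ n])
qed

lemma unitary_diag_conj:
  assumes "unitary_diag n A U d" and V: "mat_unitary n V"
  shows "unitary_diag n (V * A * mat_adjoint V) (V * U) d"
proof -
  have u: "mat_unitary n U" and A: "A = U * mat_diag n (\<lambda>i. complex_of_real (d i)) * mat_adjoint U"
    using assms by (auto simp: unitary_diag_def)
  note U = mat_unitaryD[OF u] and V' = mat_unitaryD[OF V]
  show ?thesis
    using U(1,2) V'(1,2) mat_unitary_mult[OF V u] unfolding A unitary_diag_def
    by (simp add: mat_adjoint_mult[of _ n n _ n] mult_carrier_mat[of _ n n _ n]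
        assoc_mult_mat[of _ n n _ n _ n])
qed

text \<open>Both sides are diagonalised by \<open>V * U\<close> with eigenvalues
  \<open>g (d i)\<close>.\<close>

lemma mat_fun_conj:
  assumes "unitary_diag n A U d" and V: "mat_unitary n V"
  shows "mat_fun g (V * A * mat_adjoint V) = V * mat_fun g A * mat_adjoint V"
  by (rule unitary_diag_unique[OF unitary_diag_mat_fun[OF unitary_diag_conj[OF assms]]
        unitary_diag_conj[OF unitary_diag_mat_fun[OF assms(1)] V]])

text \<open>\<open>U\<close> and \<open>V\<close> act on separate blocks, so the eigenvalue lists
  are concatenated; \<open>i - n\<close> restarts the second list at 0.\<close>

lemma unitary_diag_four_block:
  assumes A: "unitary_diag n A U d" and B: "unitary_diag m B V e"
  shows "unitary_diag (n + m) (four_block_mat A (0\<^sub>m n m) (0\<^sub>m m n) B)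
    (four_block_mat U (0\<^sub>m n m) (0\<^sub>m m n) V) (\<lambda>i. if i < n then d i else e (i - n))"
proof -
  have u: "mat_unitary n U" and A': "A = U * mat_diag n (\<lambda>i. complex_of_real (d i)) * mat_adjoint U"
    and v: "mat_unitary m V" and B': "B = V * mat_diag m (\<lambda>i. complex_of_real (e i)) * mat_adjoint V"
    using A B by (auto simp: unitary_diag_def)
  note U = mat_unitaryD[OF u] and V = mat_unitaryD[OF v]
  have UD: "U * mat_diag n (\<lambda>i. complex_of_real (d i)) \<in> carrier_mat n n"
    and VD: "V * mat_diag m (\<lambda>i. complex_of_real (e i)) \<in> carrier_mat m m"
    using U V by (auto intro: mult_carrier_mat)
  have D: "mat_diag (n + m) (\<lambda>i. complex_of_real (if i < n then d i else e (i - n)))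
      = four_block_mat (mat_diag n (\<lambda>i. complex_of_real (d i))) (0\<^sub>m n m) (0\<^sub>m m n)
          (mat_diag m (\<lambda>i. complex_of_real (e i)))"
    by (rule eq_matI) (auto simp: mat_diag_def)
  show ?thesis
    unfolding unitary_diag_def D A' B'
    using U V UD VD mat_unitary_four_block[OF u v]
    by (simp add: mat_adjoint_four_block[OF U(1) _ _ V(1)] mult_block_diag_mat)
qed

lemma mat_fun_four_block:
  assumes A: "unitary_diag n A U d" and B: "unitary_diag m B V e"
  shows "mat_fun g (four_block_mat A (0\<^sub>m n m) (0\<^sub>m m n) B)
    = four_block_mat (mat_fun g A) (0\<^sub>m n m) (0\<^sub>m m n) (mat_fun g B)"
proof -
  \<comment> \<open>\<open>g\<close> is moved inside the conditional so that the two eigenvalue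
    lists agree literally.\<close>
  have "(\<lambda>i. g (if i < n then d i else e (i - n))) = (\<lambda>i. if i < n then g (d i) else g (e (i - n)))"
    by auto
  then show ?thesis
    using unitary_diag_unique[OF unitary_diag_mat_fun[OF unitary_diag_four_block[OF A B], of g]]
      unitary_diag_four_block[OF unitary_diag_mat_fun[OF A, of g] unitary_diag_mat_fun[OF B, of g]]
    by simp
qed

text \<open>\<open>A\<close> is similar to the diagonal matrix, so its characteristic polynomial is
  the product of linear factors with roots \<open>d i\<close>, and the spectrum is the set of these
  roots.\<close>

lemma unitary_diag_spectrum:
  assumes "unitary_diag n A U d"
  shows "spectrum A = complex_of_real ` d ` {..<n}"
proof -
  have u: "mat_unitary n U" and A: "A = U * mat_diag n (\<lambda>i. complex_of_real (d i)) * mat_adjoint U"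
    using assms by (auto simp: unitary_diag_def)
  note U = mat_unitaryD[OF u]
  have Ac: "A \<in> carrier_mat n n" by (rule unitary_diag_carrier[OF assms])
  let ?D = "mat_diag n (\<lambda>i. complex_of_real (d i))"
  have "similar_mat_wit A ?D U (mat_adjoint U)"
    by (rule similar_mat_witI[OF U(3,4) A Ac mat_diag_dim U(1,2)])
  then have "char_poly A = char_poly ?D"
    by (intro char_poly_similar) (auto simp: similar_mat_def)
  also have "\<dots> = (\<Prod>a\<leftarrow>diag_mat ?D. [:- a, 1:])"
    by (rule char_poly_upper_triangular[OF mat_diag_dim]) (auto simp: mat_diag_def)
  finally have cp: "char_poly A = (\<Prod>a\<leftarrow>diag_mat ?D. [:- a, 1:])" .
  have "diag_mat ?D = map (\<lambda>i. complex_of_real (d i)) [0..<n]"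
    by (auto simp: diag_mat_def mat_diag_def)
  then have "spectrum A = set (map (\<lambda>i. complex_of_real (d i)) [0..<n])"
    unfolding spectrum_root_char_poly[OF Ac] cp
    by (auto simp: poly_prod_list prod_list_zero_iff o_def)
  then show ?thesis by (auto simp: image_image)
qed

section \<open>Positive semidefinite matrices\<close>

text \<open>Moving \<open>X\<close> across the inner product turns the quadratic form at
  \<open>v\<close> into that of \<open>P\<close> at \<open>mat_adjoint X *\<^sub>v v\<close>;
  \<open>X\<close> may be rectangular.\<close>

lemma mat_psd_conj:
  assumes P: "mat_psd P" "P \<in> carrier_mat m m" and X: "X \<in> carrier_mat n m"
  shows "mat_psd (X * P * mat_adjoint X)"
proof -
  have X': "mat_adjoint X \<in> carrier_mat m n" using X by simp
  have PX: "P * mat_adjoint X \<in> carrier_mat m n" "X * P \<in> carrier_mat n m"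
    using P(2) X X' by auto
  have eq: "mat_adjoint P = P" using P(1) by (simp add: mat_psd_def mat_hermitian_def)
  have herm: "mat_adjoint (X * P * mat_adjoint X) = X * P * mat_adjoint X"
    unfolding mat_adjoint_mult[OF PX(2) X'] mat_adjoint_mult[OF X P(2)] eq mat_adjoint_adjoint
    by (rule assoc_mult_mat[OF X P(2) X', symmetric])
  have "0 \<le> (X * P * mat_adjoint X *\<^sub>v v) \<bullet>c v" if v: "v \<in> carrier_vec n" for v
  proof -
    have w: "mat_adjoint X *\<^sub>v v \<in> carrier_vec m" using X' v by simp
    have "(X * P * mat_adjoint X *\<^sub>v v) = X *\<^sub>v (P *\<^sub>v (mat_adjoint X *\<^sub>v v))"
      using P(2) X X' PX v by (simp add: assoc_mult_mat_vec[OF PX(2) X' v] assoc_mult_mat_vec[OF X P(2) w])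
    then have "(X * P * mat_adjoint X *\<^sub>v v) \<bullet>c v
        = (P *\<^sub>v (mat_adjoint X *\<^sub>v v)) \<bullet>c (mat_adjoint X *\<^sub>v v)"
      using cscalar_prod_mat_adjoint[OF X _ v, of "P *\<^sub>v (mat_adjoint X *\<^sub>v v)"] P(2) w by simp
    then show ?thesis using P w by (auto simp: mat_psd_def)
  qed
  then show ?thesis
    using herm X by (auto simp: mat_psd_def mat_hermitian_def)
qed

text \<open>The form of the diagonal matrix is the sum of \<open>d i\<close> times the squared
  moduli of the coordinates; conjugation by \<open>U\<close> transfers positivity to
  \<open>A\<close>.\<close>

lemma unitary_diag_psd:
  assumes "unitary_diag n A U d" and nonneg: "\<And>i. i < n \<Longrightarrow> 0 \<le> d i"
  shows "mat_psd A"
proof -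
  have u: "mat_unitary n U" and A: "A = U * mat_diag n (\<lambda>i. complex_of_real (d i)) * mat_adjoint U"
    using assms by (auto simp: unitary_diag_def)
  let ?D = "mat_diag n (\<lambda>i. complex_of_real (d i))"
  have "(?D *\<^sub>v v) \<bullet>c v = (\<Sum>i<n. complex_of_real (d i * (cmod (v $ i))\<^sup>2))"
    if v: "v \<in> carrier_vec n" for v
  proof -
    have "(?D *\<^sub>v v) $ i = complex_of_real (d i) * v $ i" if i: "i < n" for i
    proof -
      have "(?D *\<^sub>v v) $ i = (\<Sum>j<n. (if i = j then complex_of_real (d j) else 0) * v $ j)"
        using i v by (simp add: mat_diag_def scalar_prod_def atLeast0LessThan)
      also have "\<dots> = (\<Sum>j<n. if i = j then complex_of_real (d j) * v $ j else 0)"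
        by (intro sum.cong) auto
      finally show ?thesis using i by simp
    qed
    moreover have "dim_row ?D = n" by (simp add: mat_diag_def)
    ultimately show ?thesis
      using v by (auto simp: scalar_prod_def atLeast0LessThan mult.assoc
          complex_norm_square[symmetric] simp del: index_mult_mat_vec of_real_power intro!: sum.cong)
  qed
  then have "0 \<le> (?D *\<^sub>v v) \<bullet>c v" if "v \<in> carrier_vec n" for v
    using that nonneg by (auto intro!: sum_nonneg simp: less_eq_complex_def)
  then have "mat_psd ?D"
    unfolding mat_psd_def mat_hermitian_def mat_adjoint_diag_real by (auto simp: mat_diag_def)
  then show ?thesis
    unfolding A by (rule mat_psd_conj) (use mat_unitaryD[OF u] in auto)
qed

section \<open>The spectral theorem for Hermitian matrices\<close>

text \<open>The vector is completed to a basis, which is orthogonalised and then normalised. The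
  factor \<open>c\<close> absorbs the normalisation: only the direction of the first column is
  needed to split off an eigenvector.\<close>

lemma unitary_complete:
  fixes v :: "complex vec"
  assumes v: "v \<in> carrier_vec n" and v0: "v \<noteq> 0\<^sub>v n"
  obtains U c where "mat_unitary n U" "col U 0 = c \<cdot>\<^sub>v v"
proof -
  interpret cof_vec_space n "TYPE(complex)" .
  define b where "b = basis_completion v"
  define ws where "ws = gram_schmidt n b"
  note b = basis_completion[OF v v0, folded b_def]
  note gs = gram_schmidt_result[OF b(2,4,5) refl, folded ws_def]
  have n0: "0 < n" using v v0 by (cases n) auto
  then obtain vs where "b = v # vs" using b(6,7) by (cases b) auto
  \<comment> \<open>Gram-Schmidt leaves the first vector of the list unchanged.\<close>
  then have hd: "hd ws = v" unfolding ws_def using v by simp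
  have len: "length ws = n" using gs(4) b(6) by simp
  then have ws0: "ws ! 0 = v" using hd n0 by (cases ws) auto
  have wc: "ws ! i \<in> carrier_vec n" if "i < n" for i
    using gs(3) len that by (auto simp: set_conv_nth)
  define nrm where "nrm i = sqrt (Re (ws ! i \<bullet>c ws ! i))" for i
  \<comment> \<open>Orthogonality of the list includes that no member has vanishing square, so
    dividing by \<open>nrm i\<close> is legitimate.\<close>
  have pos: "0 < ws ! i \<bullet>c ws ! i" if "i < n" for i
    using corthogonalD[OF gs(2), of i i] that len wc[OF that] conjugate_square_ge_0_vec[of "ws ! i"]
    by (auto simp: order_less_le)
  have nrm: "complex_of_real (nrm i) * complex_of_real (nrm i) = ws ! i \<bullet>c ws ! i" "nrm i \<noteq> 0" if "i < n" for i
    using pos[OF that] by (auto simp: nrm_def less_complex_def complex_eq_iff simp flip: of_real_mult)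
  define U where "U = Matrix.mat n n (\<lambda>(i, j). ws ! j $ i / complex_of_real (nrm j))"
  have Uc: "U \<in> carrier_mat n n" by (simp add: U_def)
  have ent: "(\<Sum>k<n. cnj (ws ! i $ k) * ws ! j $ k)
      = (if i = j then complex_of_real (nrm i) * complex_of_real (nrm i) else 0)"
    if "i < n" "j < n" for i j
  proof -
    have "(\<Sum>k<n. cnj (ws ! i $ k) * ws ! j $ k) = ws ! j \<bullet>c ws ! i"
      using wc[OF that(1)] wc[OF that(2)]
      by (simp add: scalar_prod_def atLeast0LessThan mult.commute)
    then show ?thesis
      using corthogonalD[OF gs(2), of j i] that len nrm by auto
  qed
  have UU: "mat_adjoint U * U = 1\<^sub>m n"
  proof (rule eq_matI)
    fix i j assume "i < dim_row (1\<^sub>m n)" "j < dim_col (1\<^sub>m n)"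
    then have ij: "i < n" "j < n" by auto
    have "(mat_adjoint U * U) $$ (i, j)
        = (\<Sum>k<n. cnj (ws ! i $ k) * ws ! j $ k) / (complex_of_real (nrm i) * complex_of_real (nrm j))"
      using ij by (simp add: U_def scalar_prod_def atLeast0LessThan sum_divide_distrib)
    then show "(mat_adjoint U * U) $$ (i, j) = 1\<^sub>m n $$ (i, j)"
      using ij nrm(2) by (auto simp: ent simp flip: nrm(1))
  qed (simp_all add: U_def)
  \<comment> \<open>For square matrices a left inverse is a right inverse, so orthonormal columns
    suffice.\<close>
  have "U * mat_adjoint U = 1\<^sub>m n"
    using mat_mult_left_right_inverse[OF _ Uc UU] Uc by simp
  with UU Uc have "mat_unitary n U" by (simp add: mat_unitary_def)
  moreover have "col U 0 = (1 / complex_of_real (nrm 0)) \<cdot>\<^sub>v v"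
    using n0 ws0 v by (intro eq_vecI) (auto simp: U_def)
  ultimately show ?thesis by (rule that)
qed

text \<open>Deflation: in a unitary basis starting with an eigenvector, a Hermitian matrix is the
  direct sum of the eigenvalue and a smaller Hermitian matrix, to which the induction hypothesis
  applies.\<close>

theorem hermitian_unitary_diag:
  assumes "A \<in> carrier_mat n n" "mat_adjoint A = A"
  shows "\<exists>U d. unitary_diag n A U d"
  using assms
proof (induction n arbitrary: A)
  case 0
  then have "unitary_diag 0 A (1\<^sub>m 0) (\<lambda>_. 0)"
    by (auto simp: unitary_diag_def mat_unitary_def)
  then show ?case by blast
next
  case (Suc n)
  note A = Suc.prems(1)
  obtain e where "e \<in> spectrum A" using spectrum_non_empty[OF A] by auto
  then obtain v where v: "v \<in> carrier_vec (Suc n)" "v \<noteq> 0\<^sub>v (Suc n)" "A *\<^sub>v v = e \<cdot>\<^sub>v v"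
    using A by (auto simp: spectrum_def eigenvalue_def eigenvector_def)
  obtain U c where u: "mat_unitary (Suc n) U" and col: "col U 0 = c \<cdot>\<^sub>v v"
    using unitary_complete[OF v(1,2)] by blast
  note U = mat_unitaryD[OF u]
  define M where "M = mat_adjoint U * A * U"
  have Mc: "M \<in> carrier_mat (Suc n) (Suc n)"
    unfolding M_def using U A by (auto intro: mult_carrier_mat)
  have Mh: "mat_adjoint M = M"
    unfolding M_def using U(1,2) A Suc.prems(2)
    by (simp add: mat_adjoint_mult[of _ "Suc n" "Suc n" _ "Suc n"]
        mult_carrier_mat[of _ "Suc n" "Suc n" _ "Suc n"]
        assoc_mult_mat[of _ "Suc n" "Suc n" _ "Suc n" _ "Suc n"])
  have AM: "A = U * M * mat_adjoint U"
  proof -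
    have "U * M * mat_adjoint U = (U * mat_adjoint U) * A * (U * mat_adjoint U)"
      unfolding M_def using U(1,2) A
      by (simp add: mult_carrier_mat[of _ "Suc n" "Suc n" _ "Suc n"]
        assoc_mult_mat[of _ "Suc n" "Suc n" _ "Suc n" _ "Suc n"])
    then show ?thesis using U A by simp
  qed
  have cU: "col U 0 \<in> carrier_vec (Suc n)"
    by (rule col_carrier_vec[OF _ U(1)]) simp
  \<comment> \<open>As \<open>col U 0\<close> is an eigenvector, the first column of
    \<open>M\<close> turns out to be \<open>e\<close> times the first unit vector.\<close>
  have "col M 0 = mat_adjoint U *\<^sub>v (A *\<^sub>v col U 0)"
  proof -
    have "col M 0 = (mat_adjoint U * A) *\<^sub>v col U 0"
      unfolding M_def using U A by (intro col_mult2) (auto intro: mult_carrier_mat)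
    then show ?thesis by (simp add: assoc_mult_mat_vec[OF U(2) A cU])
  qed
  also have "A *\<^sub>v col U 0 = e \<cdot>\<^sub>v col U 0"
    unfolding col using A v by (simp add: mult_mat_vec[OF A] smult_smult_assoc mult.commute)
  also have "mat_adjoint U *\<^sub>v (e \<cdot>\<^sub>v col U 0) = e \<cdot>\<^sub>v col (mat_adjoint U * U) 0"
    using U(1,2) by (simp add: mult_mat_vec[OF U(2) cU] col_mult2[OF U(2,1)])
  finally have col0: "col M 0 = e \<cdot>\<^sub>v col (1\<^sub>m (Suc n)) 0" using U(4) by simp
  have M0: "M $$ (i, 0) = (if i = 0 then e else 0)" if "i < Suc n" for i
    using arg_cong[OF col0, of "\<lambda>w. w $ i"] that Mc by auto
  \<comment> \<open>Hermitian symmetry carries the zeros of the first column over to the first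
    row.\<close>
  have M0': "M $$ (0, i) = cnj (M $$ (i, 0))" if "i < Suc n" for i
    using arg_cong[OF Mh, of "\<lambda>N. N $$ (0, i)"] that Mc by auto
  \<comment> \<open>The corner entry equals its own conjugate, so the eigenvalue is real and may
    enter the real list \<open>d\<close>.\<close>
  have e: "e = complex_of_real (Re e)"
    using M0[of 0] M0'[of 0] by (auto simp: complex_eq_iff)
  then have cnj_e: "cnj e = e" by (metis complex_cnj_complex_of_real)
  define E where "E = Matrix.mat 1 1 (\<lambda>_. e)"
  define N where "N = Matrix.mat n n (\<lambda>(i, j). M $$ (Suc i, Suc j))"
  have "N \<in> carrier_mat n n" by (simp add: N_def)
  moreover have "mat_adjoint N = N"
  proof (rule eq_matI)
    fix i j assume "i < dim_row N" "j < dim_col N"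
    then have ij: "i < n" "j < n" by (auto simp: N_def)
    have "M $$ (Suc i, Suc j) = cnj (M $$ (Suc j, Suc i))"
      using arg_cong[OF Mh, of "\<lambda>X. X $$ (Suc i, Suc j)"] ij Mc by auto
    then show "mat_adjoint N $$ (i, j) = N $$ (i, j)" using ij by (simp add: N_def)
  qed (simp_all add: N_def)
  ultimately obtain V d where V: "unitary_diag n N V d" using Suc.IH by blast
  have "unitary_diag 1 E (1\<^sub>m 1) (\<lambda>_. Re e)"
    unfolding unitary_diag_def using e
    by (auto simp: mat_unitary_one E_def mat_diag_def intro!: eq_matI)
  note * = unitary_diag_four_block[OF this V]
  have "four_block_mat E (0\<^sub>m 1 n) (0\<^sub>m n 1) N = M"
    using Mc M0 M0' cnj_e by (intro eq_matI) (auto simp: E_def N_def)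
  then show ?case
    using unitary_diag_conj[OF _ u, of M] * AM by auto
qed


section \<open>Restriction to a corner\<close>

text \<open>The quadratic form of the block matrix at \<open>v\<close> padded with \<open>m\<close>
  zeros is that of \<open>A\<close> at \<open>v\<close>.\<close>

lemma mat_psd_corner:
  assumes psd: "mat_psd (four_block_mat A B C D)"
    and c: "A \<in> carrier_mat n n" "B \<in> carrier_mat n m" "C \<in> carrier_mat m n" "D \<in> carrier_mat m m"
  shows "mat_psd A"
proof -
  let ?M = "four_block_mat A B C D"
  have M: "?M \<in> carrier_mat (n + m) (n + m)" using c by simp
  have adj: "mat_adjoint ?M = ?M" using psd by (simp add: mat_psd_def mat_hermitian_def)
  have "mat_adjoint A = A"
  proof (rule eq_matI)
    fix i j assume "i < dim_row A" "j < dim_col A"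
    then show "mat_adjoint A $$ (i, j) = A $$ (i, j)"
      using arg_cong[OF adj, of "\<lambda>N. N $$ (i, j)"] c by simp
  qed (use c in simp_all)
  moreover have "0 \<le> (A *\<^sub>v v) \<bullet>c v" if v: "v \<in> carrier_vec n" for v
  proof -
    have B0: "B *\<^sub>v 0\<^sub>v m = 0\<^sub>v n" "D *\<^sub>v 0\<^sub>v m = 0\<^sub>v m"
      using c by (auto intro!: eq_vecI)
    have Av: "A *\<^sub>v v \<in> carrier_vec n" "C *\<^sub>v v \<in> carrier_vec m" using c v by auto
    have "conjugate (v @\<^sub>v 0\<^sub>v m) = conjugate v @\<^sub>v 0\<^sub>v m"
      using v by (intro eq_vecI) (auto simp: append_vec_def)
    moreover have "?M *\<^sub>v (v @\<^sub>v 0\<^sub>v m) = (A *\<^sub>v v) @\<^sub>v (C *\<^sub>v v)"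
      using Av by (simp add: four_block_mat_mult_vec[OF c v zero_carrier_vec] B0)
    ultimately have "(?M *\<^sub>v (v @\<^sub>v 0\<^sub>v m)) \<bullet>c (v @\<^sub>v 0\<^sub>v m) = (A *\<^sub>v v) \<bullet>c v"
      using v Av by (simp add: scalar_prod_append[OF Av(1) Av(2)])
    moreover have "v @\<^sub>v 0\<^sub>v m \<in> carrier_vec (n + m)" using v by simp
    ultimately show ?thesis using psd M unfolding mat_psd_def by (metis carrier_matD(1))
  qed
  ultimately show ?thesis using c by (simp add: mat_psd_def mat_hermitian_def)
qed

text \<open>Subtraction is blockwise, so the corner of the difference is the difference of the
  corners.\<close>

lemma loewner_le_corner:
  assumes le: "four_block_mat A B C D \<le>\<^sub>L four_block_mat A' B' C' D'"
    and c: "A \<in> carrier_mat n n" "B \<in> carrier_mat n m" "C \<in> carrier_mat m n" "D \<in> carrier_mat m m"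
    and c': "A' \<in> carrier_mat n n" "B' \<in> carrier_mat n m" "C' \<in> carrier_mat m n" "D' \<in> carrier_mat m m"
  shows "A \<le>\<^sub>L A'"
proof -
  have "four_block_mat A' B' C' D' - four_block_mat A B C D
      = four_block_mat (A' - A) (B' - B) (C' - C) (D' - D)"
    using c c' by (intro eq_matI) auto
  then have "mat_psd (four_block_mat (A' - A) (B' - B) (C' - C) (D' - D))"
    using le by (simp add: loewner_le_def)
  then have "mat_psd (A' - A)"
    by (rule mat_psd_corner[where n = n and m = m]) (use c c' in auto)
  then show ?thesis using c c' by (simp add: loewner_le_def)
qed

section \<open>Unitary dilation and pinching\<close>

text \<open>Halmos' dilation of a coisometry \<open>W\<close> to a unitary on a space that is larger by \<open>n\<close>
  dimensions; it avoids completing the rows of \<open>W\<close> to an orthonormal basis.\<close>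

lemma coisometry_dilation:
  fixes W :: "complex mat"
  assumes W: "W \<in> carrier_mat n m" and WW: "W * mat_adjoint W = 1\<^sub>m n"
  defines "P \<equiv> 1\<^sub>m m - mat_adjoint W * W"
  defines "U \<equiv> four_block_mat W (0\<^sub>m n n) P (mat_adjoint W)"
  shows "mat_unitary (n + m) U"
    and "\<And>X E. X \<in> carrier_mat m m \<Longrightarrow> E \<in> carrier_mat n n \<Longrightarrow>
      U * four_block_mat X (0\<^sub>m m n) (0\<^sub>m n m) E * mat_adjoint U
      = four_block_mat (W * X * mat_adjoint W) (W * X * P) (P * X * mat_adjoint W)
          (P * X * P + mat_adjoint W * E * W)"
proof -
  have W': "mat_adjoint W \<in> carrier_mat m n" using W by simp
  have Q: "mat_adjoint W * W \<in> carrier_mat m m" using W W' by (rule mult_carrier_mat[rotated])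
  have P: "P \<in> carrier_mat m m" using Q by (simp add: P_def minus_carrier_mat)
  have adjP: "mat_adjoint P = P"
    by (simp add: P_def mat_adjoint_minus[OF one_carrier_mat Q] mat_adjoint_mult[OF W' W])
  have adjU: "mat_adjoint U = four_block_mat (mat_adjoint W) P (0\<^sub>m n n) W"
    unfolding U_def using mat_adjoint_four_block[OF W zero_carrier_mat P W'] by (simp add: adjP)
  \<comment> \<open>\<open>P\<close> is the orthogonal projection onto the kernel of
    \<open>W\<close>. The relations collected from here on, together with \<open>WW\<close>, are
    exactly what the block products need to collapse to identity matrices.\<close>
  have WP: "W * P = 0\<^sub>m n m"
  proof -
    have "W * P = W - W * mat_adjoint W * W"
      using W W' by (simp add: P_def mult_minus_distrib_mat[OF W one_carrier_mat Q] assoc_mult_mat[OF W W' W])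
    then show ?thesis using W by (simp add: WW)
  qed
  have PW: "P * mat_adjoint W = 0\<^sub>m m n"
    using arg_cong[OF WP, of mat_adjoint] by (simp add: mat_adjoint_mult[OF W P] adjP)
  have PP: "P * P = P"
  proof -
    have "P * P = P * 1\<^sub>m m - P * (mat_adjoint W * W)"
      using mult_minus_distrib_mat[OF P one_carrier_mat Q] by (simp flip: P_def)
    also have "P * (mat_adjoint W * W) = 0\<^sub>m m m"
      using W by (simp add: assoc_mult_mat[OF P W' W, symmetric] PW)
    also have "P * 1\<^sub>m m - 0\<^sub>m m m = P"
      using P by (intro eq_matI) auto
    finally show ?thesis .
  qed
  have PQ: "P + mat_adjoint W * W = 1\<^sub>m m" "mat_adjoint W * W + P = 1\<^sub>m m"
    unfolding P_def using Q by (intro eq_matI; auto)+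
  have "U * mat_adjoint U = 1\<^sub>m (n + m)"
    unfolding adjU unfolding U_def
    using W W' P by (simp add: mult_four_block_mat[OF W zero_carrier_mat P W' W' P zero_carrier_mat W]
        WW WP PW PP PQ)
  moreover have "mat_adjoint U * U = 1\<^sub>m (m + n)"
    unfolding adjU unfolding U_def
    using W W' P by (simp add: mult_four_block_mat[OF W' P zero_carrier_mat W W zero_carrier_mat P W']
        WW WP PW PP PQ)
  \<comment> \<open>Rows are split as \<open>n\<close>, \<open>m\<close> and columns as
    \<open>m\<close>, \<open>n\<close>: conjugation by \<open>U\<close> takes an upper left block of
    size \<open>m\<close> to one of size \<open>n\<close>.\<close>
  moreover have "U \<in> carrier_mat (n + m) (m + n)"
    unfolding U_def using W W' by simp
  ultimately show "mat_unitary (n + m) U"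
    by (simp add: mat_unitary_def add.commute)
  fix X E :: "complex mat"
  assume X: "X \<in> carrier_mat m m" and E: "E \<in> carrier_mat n n"
  have c: "W * X \<in> carrier_mat n m" "P * X \<in> carrier_mat m m" "mat_adjoint W * E \<in> carrier_mat m n"
    "W * X * mat_adjoint W \<in> carrier_mat n n" "W * X * P \<in> carrier_mat n m"
    "P * X * mat_adjoint W \<in> carrier_mat m n" "P * X * P \<in> carrier_mat m m"
    using W W' P X E by (auto intro!: mult_carrier_mat)
  have 1: "U * four_block_mat X (0\<^sub>m m n) (0\<^sub>m n m) E
      = four_block_mat (W * X) (0\<^sub>m n n) (P * X) (mat_adjoint W * E)"
    unfolding U_def using W W' P X E c
    by (simp add: mult_four_block_mat[OF W zero_carrier_mat P W' X zero_carrier_mat zero_carrier_mat E])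
  show "U * four_block_mat X (0\<^sub>m m n) (0\<^sub>m n m) E * mat_adjoint U
      = four_block_mat (W * X * mat_adjoint W) (W * X * P) (P * X * mat_adjoint W)
          (P * X * P + mat_adjoint W * E * W)"
    unfolding 1 adjU using W W' P X E c
    by (simp add: mult_four_block_mat[OF c(1) zero_carrier_mat c(2,3) W' P zero_carrier_mat W])
qed

text \<open>Conjugation by the symmetry \<open>V\<close> flips the signs of the off-diagonal blocks, so
  averaging over \<open>V\<close> is the pinching to the diagonal blocks.\<close>

lemma conj_symmetry_four_block:
  fixes A :: "complex mat"
  assumes c: "A \<in> carrier_mat n n" "B \<in> carrier_mat n m" "C \<in> carrier_mat m n" "D \<in> carrier_mat m m"
  defines "V \<equiv> four_block_mat (1\<^sub>m n) (0\<^sub>m n m) (0\<^sub>m m n) (- 1\<^sub>m m)"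
  shows "mat_unitary (n + m) V"
    and "V * four_block_mat A B C D * mat_adjoint V = four_block_mat A (- B) (- C) D"
proof -
  have one: "(- 1\<^sub>m m :: complex mat) \<in> carrier_mat m m" by simp
  have "mat_unitary m (- 1\<^sub>m m)"
    using uminus_mult_left_mat[of "1\<^sub>m m" "- 1\<^sub>m m :: complex mat"]
    by (simp add: mat_unitary_def)
  then show "mat_unitary (n + m) V"
    unfolding V_def by (rule mat_unitary_four_block[OF mat_unitary_one])
  have adj: "mat_adjoint V = V"
    unfolding V_def by (simp add: mat_adjoint_four_block[OF one_carrier_mat zero_carrier_mat zero_carrier_mat one])
  have neg: "- 1\<^sub>m m * X = - X" if "X \<in> carrier_mat m k" for X :: "complex mat" and k
    using that uminus_mult_left_mat[of "1\<^sub>m m" X] by simp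
  have neg': "X * - 1\<^sub>m m = - X" if "X \<in> carrier_mat k m" for X :: "complex mat" and k
    using that uminus_mult_right_mat[of X "1\<^sub>m m"] by simp
  have c': "- C \<in> carrier_mat m n" "- D \<in> carrier_mat m m" using c by auto
  \<comment> \<open>From the left \<open>V\<close> negates the lower block row, from the right the
    second block column; \<open>D\<close> is negated twice and keeps its sign.\<close>
  have 1: "V * four_block_mat A B C D = four_block_mat A B (- C) (- D)"
    unfolding V_def using c c'
    by (simp add: mult_four_block_mat[OF one_carrier_mat zero_carrier_mat zero_carrier_mat one c]
        neg[OF c(3)] neg[OF c(4)])
  show "V * four_block_mat A B C D * mat_adjoint V = four_block_mat A (- B) (- C) D"
    unfolding adj 1 unfolding V_def using c c'
    by (simp add: mult_four_block_mat[OF c(1,2) c' one_carrier_mat zero_carrier_mat zero_carrier_mat one]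
        neg'[OF c(2)] neg'[OF c'(2)])
qed

section \<open>The inequality for a single coisometry\<close>

lemma operator_ph_convex_onD:
  assumes "operator_ph_convex_on p h K f" "n \<ge> 1" "A \<in> carrier_mat n n" "B \<in> carrier_mat n n"
    "mat_psd A" "mat_psd B" "spectrum A \<subseteq> complex_of_real ` K" "spectrum B \<subseteq> complex_of_real ` K"
    "0 < \<alpha>" "\<alpha> < 1"
  shows "mat_fun f (mat_powr (complex_of_real \<alpha> \<cdot>\<^sub>m mat_powr A p
      + complex_of_real (1 - \<alpha>) \<cdot>\<^sub>m mat_powr B p) (1 / p))
    \<le>\<^sub>L complex_of_real (h \<alpha>) \<cdot>\<^sub>m mat_fun f A + complex_of_real (h (1 - \<alpha>)) \<cdot>\<^sub>m mat_fun f B"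
proof -
  have "\<alpha> \<in> {0<..<1}" using assms by simp
  then show ?thesis
    using assms(1-8) unfolding operator_ph_convex_on_def by blast
qed

text \<open>A rectangular \<open>W\<close> lets the pair \<open>C\<close>, \<open>D\<close> be
  treated as one matrix. The factor \<open>2 * h (1 / 2)\<close> is
  \<open>h (1 / 2) + h (1 - 1 / 2)\<close>: both matrices fed into the convexity inequality have the
  same corner \<open>S f\<close> after applying \<open>f\<close>.\<close>

lemma operator_ph_convex_coisometry:
  assumes K: "K \<subseteq> {0..}" and f: "operator_ph_convex_on p h K f"
    and n: "n \<ge> 1" and m: "m \<ge> 1"
    and W: "W \<in> carrier_mat n m" and WW: "W * mat_adjoint W = 1\<^sub>m n"
    and X: "unitary_diag m X UX d" and spec: "spectrum X \<subseteq> complex_of_real ` K"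
  shows "mat_fun f (mat_powr (W * mat_powr X p * mat_adjoint W) (1 / p))
    \<le>\<^sub>L complex_of_real (2 * h (1 / 2)) \<cdot>\<^sub>m (W * mat_fun f X * mat_adjoint W)"
proof -
  have dK: "d i \<in> K" if "i < m" for i
  proof -
    have "complex_of_real (d i) \<in> complex_of_real ` K"
      using spec that unfolding unitary_diag_spectrum[OF X] by blast
    then show ?thesis by (simp add: inj_image_mem_iff inj_def)
  qed
  \<comment> \<open>The filler repeats the eigenvalue \<open>d 0\<close>, which exists because
    \<open>m \<ge> 1\<close>; so the dilated matrix has no spectrum outside
    \<open>K\<close>.\<close>
  define E where "E = mat_diag n (\<lambda>_. complex_of_real (d 0))"
  have E: "unitary_diag n E (1\<^sub>m n) (\<lambda>_. d 0)"
    by (simp add: unitary_diag_def mat_unitary_one E_def left_mult_one_mat[OF mat_diag_dim]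
        right_mult_one_mat[OF mat_diag_dim])
  define P where "P = 1\<^sub>m m - mat_adjoint W * W"
  define U where "U = four_block_mat W (0\<^sub>m n n) P (mat_adjoint W)"
  define V where "V = four_block_mat (1\<^sub>m n) (0\<^sub>m n m) (0\<^sub>m m n) (- 1\<^sub>m m :: complex mat)"
  note dil = coisometry_dilation[OF W WW, folded P_def, folded U_def]
  have W': "mat_adjoint W \<in> carrier_mat m n" using W by simp
  have P: "P \<in> carrier_mat m m"
    using mult_carrier_mat[OF W' W] by (simp add: P_def minus_carrier_mat)
  have Xc: "mat_fun g X \<in> carrier_mat m m" and Ec: "mat_fun g E \<in> carrier_mat n n" for g
    using unitary_diag_carrier unitary_diag_mat_fun X E by blast+
  \<comment> \<open>These are the four blocks of \<open>mat_fun g T\<close>, kept as functions of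
    \<open>g\<close> because they are used both for the power \<open>p\<close> and for
    \<open>f\<close>.\<close>
  define S where "S g = W * mat_fun g X * mat_adjoint W" for g
  define S12 where "S12 g = W * mat_fun g X * P" for g
  define S21 where "S21 g = P * mat_fun g X * mat_adjoint W" for g
  define S22 where "S22 g = P * mat_fun g X * P + mat_adjoint W * mat_fun g E * W" for g
  have S: "S g \<in> carrier_mat n n" "S12 g \<in> carrier_mat n m" "S21 g \<in> carrier_mat m n"
    "S22 g \<in> carrier_mat m m" for g
    unfolding S_def S12_def S21_def S22_def using W W' P Xc[of g] Ec[of g]
    by (auto intro!: mult_carrier_mat add_carrier_mat)
  note sym = conj_symmetry_four_block[OF S, folded V_def]
  define T where "T = U * four_block_mat X (0\<^sub>m m n) (0\<^sub>m n m) E * mat_adjoint U"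
  define T' where "T' = V * T * mat_adjoint V"
  \<comment> \<open>\<open>T\<close> and \<open>T'\<close> share this eigenvalue list. Its default
    \<open>d 0\<close> puts \<open>e i\<close> in \<open>K\<close> for every
    \<open>i\<close>.\<close>
  define e where "e = (\<lambda>i. if i < m then d i else d 0)"
  have XE: "unitary_diag (n + m) (four_block_mat X (0\<^sub>m m n) (0\<^sub>m n m) E)
      (four_block_mat UX (0\<^sub>m m n) (0\<^sub>m n m) (1\<^sub>m n)) e"
    using unitary_diag_four_block[OF X E] by (simp add: e_def add.commute)
  have T: "unitary_diag (n + m) T (U * four_block_mat UX (0\<^sub>m m n) (0\<^sub>m n m) (1\<^sub>m n)) e"
    unfolding T_def by (rule unitary_diag_conj[OF XE dil(1)])
  have T': "unitary_diag (n + m) T' (V * (U * four_block_mat UX (0\<^sub>m m n) (0\<^sub>m n m) (1\<^sub>m n))) e"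
    unfolding T'_def by (rule unitary_diag_conj[OF T sym(1)])
  have fT: "mat_fun g T = four_block_mat (S g) (S12 g) (S21 g) (S22 g)" for g
    unfolding T_def mat_fun_conj[OF XE dil(1)] mat_fun_four_block[OF X E]
    by (simp add: dil(2)[OF Xc Ec] S_def S12_def S21_def S22_def)
  have fT': "mat_fun g T' = four_block_mat (S g) (- S12 g) (- S21 g) (S22 g)" for g
    unfolding T'_def mat_fun_conj[OF T sym(1)] fT by (rule sym(2))
  have eK: "e i \<in> K" for i using dK m by (auto simp: e_def)
  have specT: "spectrum T \<subseteq> complex_of_real ` K" "spectrum T' \<subseteq> complex_of_real ` K"
    unfolding unitary_diag_spectrum[OF T] unitary_diag_spectrum[OF T'] using eK by auto
  have psdT: "mat_psd T" "mat_psd T'"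
    using unitary_diag_psd[OF T] unitary_diag_psd[OF T'] eK K by (meson atLeast_iff subsetD)+
  let ?q = "\<lambda>x. x powr p" and ?h = "complex_of_real (h (1 / 2))"
  have "mat_fun f (mat_powr (complex_of_real (1 / 2) \<cdot>\<^sub>m mat_powr T p
          + complex_of_real (1 - 1 / 2) \<cdot>\<^sub>m mat_powr T' p) (1 / p))
      \<le>\<^sub>L ?h \<cdot>\<^sub>m mat_fun f T + complex_of_real (h (1 - 1 / 2)) \<cdot>\<^sub>m mat_fun f T'"
    by (rule operator_ph_convex_onD[OF f _ unitary_diag_carrier[OF T] unitary_diag_carrier[OF T']
          psdT specT]) (use n in auto)
  \<comment> \<open>With equal weights the off-diagonal blocks, which differ in sign, cancel; the
    diagonal blocks are the same for \<open>T\<close> and \<open>T'\<close>.\<close>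
  also have "complex_of_real (1 / 2) \<cdot>\<^sub>m mat_powr T p + complex_of_real (1 - 1 / 2) \<cdot>\<^sub>m mat_powr T' p
      = four_block_mat (S ?q) (0\<^sub>m n m) (0\<^sub>m m n) (S22 ?q)" (is "?L = ?R")
    unfolding fT fT' using S[of ?q] by (intro eq_matI) auto
  finally have le: "mat_fun f (mat_powr ?R (1 / p))
      \<le>\<^sub>L ?h \<cdot>\<^sub>m mat_fun f T + complex_of_real (h (1 - 1 / 2)) \<cdot>\<^sub>m mat_fun f T'" .
  \<comment> \<open>Blockwise functional calculus requires a diagonalisation of each diagonal block.
    These blocks inherit Hermitian symmetry from \<open>mat_powr T p\<close>, so the spectral
    theorem supplies one.\<close>
  have "mat_adjoint (mat_powr T p) = mat_powr T p"
    by (rule unitary_diag_hermitian[OF unitary_diag_mat_fun[OF T]])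
  then have adj: "mat_adjoint (four_block_mat (S ?q) (S12 ?q) (S21 ?q) (S22 ?q))
      = four_block_mat (S ?q) (S12 ?q) (S21 ?q) (S22 ?q)"
    by (simp only: fT)
  have "mat_adjoint (S ?q) = S ?q"
  proof (rule eq_matI)
    fix i j assume "i < dim_row (S ?q)" "j < dim_col (S ?q)"
    then show "mat_adjoint (S ?q) $$ (i, j) = S ?q $$ (i, j)"
      using arg_cong[OF adj, of "\<lambda>N. N $$ (i, j)"] S[of ?q] by simp
  qed (use S[of ?q] in simp_all)
  then obtain U1 d1 where 1: "unitary_diag n (S ?q) U1 d1"
    using hermitian_unitary_diag[OF S(1)] by blast
  have "mat_adjoint (S22 ?q) = S22 ?q"
  proof (rule eq_matI)
    fix i j assume "i < dim_row (S22 ?q)" "j < dim_col (S22 ?q)"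
    then show "mat_adjoint (S22 ?q) $$ (i, j) = S22 ?q $$ (i, j)"
      using arg_cong[OF adj, of "\<lambda>N. N $$ (n + i, n + j)"] S[of ?q] by simp
  qed (use S[of ?q] in simp_all)
  then obtain U2 d2 where 2: "unitary_diag m (S22 ?q) U2 d2"
    using hermitian_unitary_diag[OF S(4)] by blast
  let ?g = "\<lambda>Z. mat_fun f (mat_powr Z (1 / p))"
  have g: "?g (S ?q) \<in> carrier_mat n n" "?g (S22 ?q) \<in> carrier_mat m m"
    using unitary_diag_carrier unitary_diag_mat_fun 1 2 by blast+
  \<comment> \<open>The root and then \<open>f\<close> are applied blockwise; the diagonalisations
    of the roots reuse \<open>U1\<close> and \<open>U2\<close>.\<close>
  have "?g ?R = four_block_mat (?g (S ?q)) (0\<^sub>m n m) (0\<^sub>m m n) (?g (S22 ?q))"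
    unfolding mat_fun_four_block[OF 1 2]
    by (rule mat_fun_four_block[OF unitary_diag_mat_fun[OF 1] unitary_diag_mat_fun[OF 2]])
  \<comment> \<open>The same cancellation on the right-hand side, now with both weights equal to
    \<open>h (1 / 2)\<close>.\<close>
  moreover have "?h \<cdot>\<^sub>m mat_fun f T + complex_of_real (h (1 - 1 / 2)) \<cdot>\<^sub>m mat_fun f T'
      = four_block_mat (complex_of_real (2 * h (1 / 2)) \<cdot>\<^sub>m S f) (0\<^sub>m n m) (0\<^sub>m m n)
          (complex_of_real (2 * h (1 / 2)) \<cdot>\<^sub>m S22 f)"
    unfolding fT fT' using S[of f] by (intro eq_matI) auto
  ultimately have "four_block_mat (?g (S ?q)) (0\<^sub>m n m) (0\<^sub>m m n) (?g (S22 ?q))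
      \<le>\<^sub>L four_block_mat (complex_of_real (2 * h (1 / 2)) \<cdot>\<^sub>m S f) (0\<^sub>m n m) (0\<^sub>m m n)
          (complex_of_real (2 * h (1 / 2)) \<cdot>\<^sub>m S22 f)"
    using le by simp
  from loewner_le_corner[OF this g(1) _ _ g(2)] show ?thesis
    using S[of f] by (simp add: S_def)
qed

section \<open>From a coisometry to the pair \<open>C\<close>, \<open>D\<close>\<close>

text \<open>A lower block row of height \<open>0\<close> turns a four-block matrix into the row \<open>[C D]\<close>.\<close>

lemma row_block_conj:
  fixes C :: "complex mat"
  assumes c: "C \<in> carrier_mat n m" "D \<in> carrier_mat n m"
  defines "W \<equiv> four_block_mat C D (0\<^sub>m 0 m) (0\<^sub>m 0 m)"
  assumes X: "X \<in> carrier_mat m m" "Y \<in> carrier_mat m m"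
  shows "W * four_block_mat X (0\<^sub>m m m) (0\<^sub>m m m) Y * mat_adjoint W
    = C * X * mat_adjoint C + D * Y * mat_adjoint D"
proof -
  note z = zero_carrier_mat
  have c': "mat_adjoint C \<in> carrier_mat m n" "mat_adjoint D \<in> carrier_mat m n" using c by auto
  have adj: "mat_adjoint W = four_block_mat (mat_adjoint C) (0\<^sub>m m 0) (mat_adjoint D) (0\<^sub>m m 0)"
    unfolding W_def using mat_adjoint_four_block[OF c z z] by simp
  have CX: "C * X \<in> carrier_mat n m" "D * Y \<in> carrier_mat n m" using c X by auto
  have 1: "W * four_block_mat X (0\<^sub>m m m) (0\<^sub>m m m) Y
      = four_block_mat (C * X) (D * Y) (0\<^sub>m 0 m) (0\<^sub>m 0 m)"
    unfolding W_def using c X CX by (simp add: mult_four_block_mat[OF c z z X(1) z z X(2)])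
  have 2: "C * X * mat_adjoint C \<in> carrier_mat n n" "D * Y * mat_adjoint D \<in> carrier_mat n n"
    using CX c' by auto
  \<comment> \<open>Apart from the upper left block, every block of the product has a dimension
    equal to 0, so an entrywise comparison sees only that block.\<close>
  show ?thesis
    unfolding 1 adj mult_four_block_mat[OF CX z z c'(1) z c'(2) z]
    using 2 CX c' by (intro eq_matI) auto
qed

theorem theorem3p5:
  fixes p :: real and J K :: "real set" and h f :: "real \<Rightarrow> real"
    and n :: nat and A B C D :: "complex mat"
  assumes "p > 0"
    and "is_interval J" and "J \<subseteq> {0..}" and "{0<..<1} \<subseteq> J"
    and "p_convex p K"
    and "\<forall>x\<in>J. 0 \<le> h x" and "\<exists>x\<in>J. h x \<noteq> 0" and "super_multiplicative_on J h"
    and "operator_ph_convex_on p h K f"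
    and "n \<ge> 1"
    and "A \<in> carrier_mat n n" and "B \<in> carrier_mat n n"
    and "C \<in> carrier_mat n n" and "D \<in> carrier_mat n n"
    and "mat_psd A" and "mat_psd B"
    and "spectrum A \<subseteq> complex_of_real ` K" and "spectrum B \<subseteq> complex_of_real ` K"
    and "C * mat_adjoint C + D * mat_adjoint D = 1\<^sub>m n"
  shows "mat_fun f (mat_powr (C * mat_powr A p * mat_adjoint C
                              + D * mat_powr B p * mat_adjoint D) (1 / p))
    \<le>\<^sub>L complex_of_real (2 * h (1 / 2)) \<cdot>\<^sub>m
        (C * mat_fun f A * mat_adjoint C + D * mat_fun f B * mat_adjoint D)"
proof -
  note C = \<open>C \<in> carrier_mat n n\<close> and D = \<open>D \<in> carrier_mat n n\<close>
  obtain UA a where A: "unitary_diag n A UA a"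
    using hermitian_unitary_diag[OF \<open>A \<in> carrier_mat n n\<close>] \<open>mat_psd A\<close>
    by (auto simp: mat_psd_def mat_hermitian_def)
  obtain UB b where B: "unitary_diag n B UB b"
    using hermitian_unitary_diag[OF \<open>B \<in> carrier_mat n n\<close>] \<open>mat_psd B\<close>
    by (auto simp: mat_psd_def mat_hermitian_def)
  define W where "W = four_block_mat C D (0\<^sub>m 0 n) (0\<^sub>m 0 n)"
  have W: "W \<in> carrier_mat n (n + n)"
    using four_block_carrier_mat[OF C zero_carrier_mat[of 0 n]] by (simp add: W_def)
  have fc: "mat_fun g A \<in> carrier_mat n n" "mat_fun g B \<in> carrier_mat n n" for g
    using unitary_diag_carrier unitary_diag_mat_fun A B by blast+
  \<comment> \<open>Used twice at the end: with the power \<open>p\<close> inside the root, and with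
    \<open>f\<close> on the right-hand side.\<close>
  have conj: "W * mat_fun g (four_block_mat A (0\<^sub>m n n) (0\<^sub>m n n) B) * mat_adjoint W
      = C * mat_fun g A * mat_adjoint C + D * mat_fun g B * mat_adjoint D" for g
    unfolding mat_fun_four_block[OF A B] W_def by (rule row_block_conj[OF C D fc])
  \<comment> \<open>With identity matrices in both blocks, the row formula turns the hypothesis on
    \<open>C\<close> and \<open>D\<close> into the coisometry condition.\<close>
  have WW: "W * mat_adjoint W = 1\<^sub>m n"
    using row_block_conj[OF C D one_carrier_mat one_carrier_mat, folded W_def] C D W
      \<open>C * mat_adjoint C + D * mat_adjoint D = 1\<^sub>m n\<close> by simp
  \<comment> \<open>The eigenvalues of the direct sum are those of \<open>A\<close> followed by
    those of \<open>B\<close>.\<close>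
  have spec: "spectrum (four_block_mat A (0\<^sub>m n n) (0\<^sub>m n n) B) \<subseteq> complex_of_real ` K"
    using \<open>spectrum A \<subseteq> complex_of_real ` K\<close> \<open>spectrum B \<subseteq> complex_of_real ` K\<close>
    unfolding unitary_diag_spectrum[OF unitary_diag_four_block[OF A B]]
      unitary_diag_spectrum[OF A] unitary_diag_spectrum[OF B] image_image image_subset_iff
    by auto
  have K: "K \<subseteq> {0..}" using \<open>p_convex p K\<close> by (simp add: p_convex_def)
  have nn: "n + n \<ge> 1" using \<open>n \<ge> 1\<close> by simp
  show ?thesis
    using operator_ph_convex_coisometry[OF K \<open>operator_ph_convex_on p h K f\<close> \<open>n \<ge> 1\<close> nn W WW
        unitary_diag_four_block[OF A B] spec]
    unfolding conj .
qed

end
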